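(* Consider a $(K,L,M_a,M_p,N)$-CW-MAP coded caching system with $M_a=0$, $0<M_p<N$ and $\gamma_p=\frac{KM_p}{N}$ an integer. Then the CW-MAP scheme described in the context coincides with the Maddah-Ali–Niesen (MAN) scheme for the dedicated cache network with $K$ users, $N$ files, cache size $M=M_p$ and $t=\gamma_p$. Precisely, identifying the mini-subfile $W_{n,\emptyset,T}$ with the MAN subfile $W_{n,T}$ for $T\subseteq[K]$, $|T|=\gamma_p$: (i) the subpacketization of the CW-MAP scheme is $F=\binom{K}{\gamma_p}$, the same as that of the MAN scheme; (ii) the private cache content of each user $u\in[K]$ is $\{W_{n,T}: T\in\binom{[K]}{\gamma_p},\ u\in T,\ n\in[N]\}$, the same as its MAN cache content; (iii) for every demand vector $\mathbf d=(d_1,\dots,d_K)$, every transmission of the CW-MAP scheme is of the Special Case 1 type, and the transmissions made are exactly the MAN transmissions $\bigoplus_{s\in\mathcal S}W_{d_s,\mathcal S\setminus\{s\}}$, one for each $\mathcal S\in\binom{[K]}{\gamma_p+1}$.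
   Context: **Notation.** $[K]=\{1,\dots,K\}$; $\binom{A}{t}$ is the set of $t$-element subsets of a set $A$; $\langle a\rangle_K$ is the representative of the integer $a$ modulo $K$ in $\{1,\dots,K\}$, applied elementwise to sets; $\oplus$ is bitwise XOR. **The $(K,L,M_a,M_p,N)$-CW-MAP coded caching setting.** $K,L,N$ are positive integers with $1\le L\le K\le N$. A server holds $N$ equal-size files $W_1,\dots,W_N$. There are $K$ access caches, each of capacity $M_a$ files, and $K$ users, each with a private cache of capacity $M_p$ files. User $u\in[K]$ reads its own private cache and the access caches with indices $\langle u\rangle_K,\dots,\langle u+L-1\rangle_K$. After placement, user $u$ demands file $W_{d_u}$, and the server broadcasts messages to all users. **MAN scheme** (dedicated caches of size $M$ files, $t=KM/N$ an integer). Each file is split into $\binom Kt$ equal subfiles $W_n=\{W_{n,\mathcal T}:\mathcal T\in\binom{[K]}{t}\}$; user $k$ caches $\{W_{n,\mathcal T}:k\in\mathcal T,\ \mathcal T\in\binom{[K]}{t},\ n\in[N]\}$; for demands $(d_1,\dots,d_K)$ the server transmits $X_{\mathcal S}=\bigoplus_{s\in\mathcal S}W_{d_s,\mathcal S\setminus\{s\}}$ for every $\mathcal S\in\binom{[K]}{t+1}$. **The CW-MAP scheme** (for integers $\gamma_a=KM_a/N\ge0$, $\gamma_p=KM_p/N\ge0$ with $\gamma_aL+\gamma_p\le K$). *Placement.* Each file is split into $K$ equal subfiles $W_n=\{W_{n,i}:i\in[K]\}$, and access cache $k$ stores $\{W_{n,\langle k+(j-1)L\rangle_K}:j\in[\gamma_a],\,n\in[N]\}$.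 The subfile $W_{n,i}$ is re-indexed as $W_{n,S}$ with $S=\langle\{i-\gamma_aL+1,\dots,i\}\rangle_K$, the set of users that can read it from their access caches. Any set of the form $\langle\{j-\gamma_aL+1,\dots,j\}\rangle_K$, $j\in[K]$ (of size $\gamma_aL$) is called a subfile-index set. Each subfile is split into $\binom{K-\gamma_aL}{\gamma_p}$ equal mini-subfiles $W_{n,S}=\{W_{n,S,T}:T\in\binom{[K]\setminus S}{\gamma_p}\}$, and user $u$'s private cache stores $\{W_{n,S,T}:S\text{ a subfile-index set},\,u\notin S,\,T\in\binom{[K]\setminus S}{\gamma_p},\,u\in T,\,n\in[N]\}$. The subpacketization is the number $F$ of mini-subfiles per file. If $\gamma_a=0$, the only subfile-index set is $\emptyset$ and the file is not split into subfiles, i.e. $W_{n,\emptyset}=W_n$. *Delivery.* For a triple $(u,S,T)$ with $S$ a subfile-index set, $u\notin S$, $T\in\binom{[K]\setminus(S\cup\{u\})}{\gamma_p}$, let $I=\{u\}\cup S\cup T$ with elements listed in increasing order, $I(i)$ its $i$-th element, and $I(P)=\{I(i):i\in P\}$ for a set $P$ of positions. Let $P^I_u,P^I_S,P^I_T$ be the sets of positions in $I$ of $u$, of the elements of $S$, and of the elements of $T$; for an integer $j$, $P+j=\{\langle p+j\rangle_{|I|}:p\in P\}$. A singleton is identified with its element. For each $u\in[K]$ let $D_u$ be the set of all pairs $(S,T)$ such that $S$ is a subfile-index set, $u\notin S$, and $T\in\binom{[K]\setminus(S\cup\{u\})}{\gamma_p}$. For $u=1,\dots,K$, while $D_u\ne\emptyset$: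 select any $(S,T)\in D_u$ and transmit one coded message $X'$ as follows. 1. (Special Case 1) If $S$ is the only subfile-index set contained in $I$: $X'=W_{d_u,S,T}\oplus\bigoplus_{t\in T}W_{d_t,S,(\{u\}\cup T)\setminus\{t\}}$. 2. (Special Case 2) If $I$ contains exactly two subfile-index sets, namely $S$ and $\{u\}\cup T$: let $j\in[2\gamma_aL-1]$ with $I(P^I_S+j)=\{u\}\cup T$, and put $u'=I(P^I_u+j)$, $S'=I(P^I_S+j)$, $T'=I(P^I_T+j)$; then $X'=W_{d_u,S,T}\oplus\bigoplus_{t\in T}W_{d_t,S,(\{u\}\cup T)\setminus\{t\}}\oplus W_{d_{u'},S',T'}\oplus\bigoplus_{i\in T'}W_{d_i,S',(T'\cup\{u'\})\setminus\{i\}}$. 3. (General Case) Otherwise: $X'$ is the XOR of $W_{d_u,S,T}$ and all $W_{d_{I(P^I_u+i)},\,I(P^I_S+i),\,I(P^I_T+i)}$ with $i\in[\gamma_aL+\gamma_p]$ such that $I(P^I_S+i)$ is a subfile-index set. After each transmission, for every term $W_{d_{\hat u},\hat S,\hat T}$ appearing in $X'$, remove $(\hat S,\hat T)$ from $D_{\hat u}$. *)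

theory Defs
  imports Complex_Main "HOL-Library.Word" "HOL-Library.Ramsey"
begin

text \<open>
  Users, caches, files and positions are numbered from 1.  The set of \<open>t\<close>-element subsets of \<open>A\<close>
  is the library's \<^term>\<open>nsets A t\<close>.  Mini-subfiles are words of one common (arbitrary) length, and
  \<open>W n S T\<close> is the content of the mini-subfile of file \<open>n\<close> with label \<open>(S, T)\<close>.  Cache contents are
  sets of labels.
\<close>

definition rep :: "nat \<Rightarrow> int \<Rightarrow> nat" where
  "rep K a = nat ((a - 1) mod int K) + 1"

definition XOR :: "('a \<Rightarrow> 'w::len word) \<Rightarrow> 'a set \<Rightarrow> 'w word" where
  "XOR f A = comm_monoid_set.F xor 0 f A"


section \<open>The MAN scheme\<close>

definition man_subfiles :: "nat \<Rightarrow> nat \<Rightarrow> nat set set" where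
  "man_subfiles K t = nsets {1..K} t"

definition man_subpacketization :: "nat \<Rightarrow> nat \<Rightarrow> nat" where
  "man_subpacketization K t = card (man_subfiles K t)"

definition man_cache :: "nat \<Rightarrow> nat \<Rightarrow> nat \<Rightarrow> nat \<Rightarrow> (nat \<times> nat set) set" where
  "man_cache K N t k = {(n, T). n \<in> {1..N} \<and> T \<in> man_subfiles K t \<and> k \<in> T}"

definition man_transmission ::
    "(nat \<Rightarrow> nat set \<Rightarrow> 'w::len word) \<Rightarrow> (nat \<Rightarrow> nat) \<Rightarrow> nat set \<Rightarrow> 'w word" where
  "man_transmission W d \<S> = XOR (\<lambda>s. W (d s) (\<S> - {s})) \<S>"


section \<open>Placement of the CW-MAP scheme\<close>

text \<open>
  For \<open>ga = 0\<close> a file is not split, so it consists of a single subfile.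
  Subfiles are counted by their numbers \<open>i\<close>, not by their index sets: these
  all coincide when \<open>ga * L = K\<close>, where there are still \<open>K\<close> subfiles.
\<close>

definition subfile_numbers :: "nat \<Rightarrow> nat \<Rightarrow> nat set" where
  "subfile_numbers K ga = (if ga = 0 then {1} else {1..K})"

definition access_cache :: "nat \<Rightarrow> nat \<Rightarrow> nat \<Rightarrow> nat \<Rightarrow> nat \<Rightarrow> (nat \<times> nat) set" where
  "access_cache K L N ga k =
     {(n, rep K (int k + (int j - 1) * int L)) | n j. n \<in> {1..N} \<and> j \<in> {1..ga}}"

definition index_set :: "nat \<Rightarrow> nat \<Rightarrow> nat \<Rightarrow> nat \<Rightarrow> nat set" where
  "index_set K L ga i = rep K ` {int i - int (ga * L) + 1..int i}"

definition index_sets :: "nat \<Rightarrow> nat \<Rightarrow> nat \<Rightarrow> nat set set" where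
  "index_sets K L ga = index_set K L ga ` {1..K}"

definition cw_subpacketization :: "nat \<Rightarrow> nat \<Rightarrow> nat \<Rightarrow> nat \<Rightarrow> nat" where
  "cw_subpacketization K L ga gp =
     card (SIGMA i:subfile_numbers K ga. nsets ({1..K} - index_set K L ga i) gp)"

definition cw_private_cache ::
    "nat \<Rightarrow> nat \<Rightarrow> nat \<Rightarrow> nat \<Rightarrow> nat \<Rightarrow> nat \<Rightarrow> (nat \<times> nat set \<times> nat set) set" where
  "cw_private_cache K L N ga gp u =
     {(n, S, T). n \<in> {1..N} \<and> S \<in> index_sets K L ga \<and> u \<notin> S \<and>
                 T \<in> nsets ({1..K} - S) gp \<and> u \<in> T}"

lemma rep_eq_iff:
  assumes "0 < K"
  shows "rep K a = rep K b \<longleftrightarrow> a mod int K = b mod int K"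
proof -
  have "rep K a = rep K b \<longleftrightarrow> (a - 1) mod int K = (b - 1) mod int K"
    using assms unfolding rep_def by (simp add: nat_eq_iff)
  also have "\<dots> \<longleftrightarrow> a mod int K = b mod int K"
    by (simp add: mod_eq_dvd_iff)
  finally show ?thesis .
qed

lemma rep_self: "i \<in> {1..K} \<Longrightarrow> rep K (int i) = i"
  by (auto simp: rep_def nat_eq_iff)

lemma rep_in: "0 < K \<Longrightarrow> rep K a \<in> {1..K}"
  by (auto simp: rep_def Suc_le_eq nat_less_iff)

text \<open>\<^const>\<open>index_set\<close> is the set of users that can read subfile \<open>i\<close> from their access caches.\<close>

lemma index_set_eq_readers:
  assumes "0 < K" and "i \<in> {1..K}" and "n \<in> {1..N}"
  shows "index_set K L ga i =
    {u \<in> {1..K}. \<exists>l < L. (n, i) \<in> access_cache K L N ga (rep K (int u + int l))}"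
proof (intro equalityI subsetI)
  fix u assume "u \<in> index_set K L ga i"
  then obtain a where a: "int i - int (ga * L) + 1 \<le> a" "a \<le> int i" "u = rep K a"
    by (auto simp: index_set_def)
  define m where "m = nat (int i - a)"
  have a_eq: "a = int i - int m" using a by (simp add: m_def)
  then have "int m < int (ga * L)" using a by linarith
  then have m: "m < ga * L" by (simp only: of_nat_less_iff)
  have L: "0 < L" using m by (cases L) auto
  have j: "m div L < ga" using m L by (simp add: less_mult_imp_div_less)
  have r: "rep K x mod int K = x mod int K" for x
    using rep_eq_iff[OF assms(1), of "int (rep K x)" x] rep_self[OF rep_in[OF assms(1)]] by simp
  have "rep K (int (rep K (int u + int (m mod L))) + (int (m div L + 1) - 1) * int L) = rep K (int i)"
  proof -
    have "(int (rep K (int u + int (m mod L))) + int (m div L) * int L) mod int K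
        = (int u + int (m mod L) + int (m div L) * int L) mod int K"
      by (rule mod_add_cong) (simp_all add: r)
    also have "\<dots> = (int u + int m) mod int K"
      by (metis add.assoc mod_mult_div_eq of_nat_add of_nat_mult mult.commute)
    also have "\<dots> = (a + int m) mod int K"
      by (rule mod_add_cong) (simp_all add: r a(3))
    finally show ?thesis using a_eq by (simp add: rep_eq_iff[OF assms(1)])
  qed
  then have "(n, i) \<in> access_cache K L N ga (rep K (int u + int (m mod L)))"
    using assms j unfolding access_cache_def
    by (intro CollectI exI[of _ n] exI[of _ "m div L + 1"]) (auto simp: rep_self)
  then show "u \<in> {u \<in> {1..K}. \<exists>l < L. (n, i) \<in> access_cache K L N ga (rep K (int u + int l))}"
    using L a(3) rep_in[OF assms(1)] by (auto intro!: exI[of _ "m mod L"])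
next
  fix u assume "u \<in> {u \<in> {1..K}. \<exists>l < L. (n, i) \<in> access_cache K L N ga (rep K (int u + int l))}"
  then obtain l j where u: "u \<in> {1..K}" and l: "l < L" and j: "j \<in> {1..ga}"
    and i: "i = rep K (int (rep K (int u + int l)) + (int j - 1) * int L)"
    by (auto simp: access_cache_def)
  have r: "rep K x mod int K = x mod int K" for x
    using rep_eq_iff[OF assms(1), of "int (rep K x)" x] rep_self[OF rep_in[OF assms(1)]] by simp
  define m where "m = int l + (int j - 1) * int L"
  have "int i mod int K = (int (rep K (int u + int l)) + (int j - 1) * int L) mod int K"
    by (subst i) (rule r)
  also have "\<dots> = (int u + int l + (int j - 1) * int L) mod int K"
    by (rule mod_add_cong) (simp_all add: r)
  finally have "int i mod int K = (int u + m) mod int K" by (simp add: m_def add.assoc)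
  then have "(int i - m) mod int K = int u mod int K"
    by (simp add: mod_eq_dvd_iff algebra_simps)
  then have "rep K (int i - m) = u"
    using rep_eq_iff[OF assms(1)] rep_self[OF u] by metis
  moreover have "0 \<le> m" using j by (simp add: m_def)
  moreover have "m < int (ga * L)"
  proof -
    have "int j * int L \<le> int ga * int L" using j by (intro mult_right_mono) auto
    moreover have "m = int l + int j * int L - int L" by (simp add: m_def algebra_simps)
    moreover have "int l < int L" using l by simp
    ultimately show ?thesis unfolding of_nat_mult by linarith
  qed
  ultimately show "u \<in> index_set K L ga i"
    unfolding index_set_def by (auto intro!: image_eqI[of _ _ "int i - m"])
qed


section \<open>Delivery of the CW-MAP scheme\<close>

definition element_at :: "nat set \<Rightarrow> nat \<Rightarrow> nat" where
  "element_at I i = sorted_list_of_set I ! (i - 1)"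

definition positions :: "nat set \<Rightarrow> nat set \<Rightarrow> nat set" where
  "positions I A = {i \<in> {1..card I}. element_at I i \<in> A}"

definition shift_positions :: "nat set \<Rightarrow> nat set \<Rightarrow> nat \<Rightarrow> nat set" where
  "shift_positions I P j = (\<lambda>p. rep (card I) (int p + int j)) ` P"

text \<open>\<open>shifted I A j\<close> is $I(P^I_A + j)$.\<close>

definition shifted :: "nat set \<Rightarrow> nat set \<Rightarrow> nat \<Rightarrow> nat set" where
  "shifted I A j = element_at I ` shift_positions I (positions I A) j"

definition shifted_elem :: "nat set \<Rightarrow> nat \<Rightarrow> nat \<Rightarrow> nat" where
  "shifted_elem I u j = the_elem (shifted I {u} j)"

text \<open>
  A triple \<open>(u, S, T)\<close> stands for the term \<open>W (d u) S T\<close>.  A coded message is given by the set of its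
  triples; the terms listed in each case of the delivery have pairwise distinct triples, so the XOR
  over this set is the XOR of the listed terms.
\<close>

type_synonym triple = "nat \<times> nat set \<times> nat set"

datatype delivery_case = Special_Case_1 | Special_Case_2 | General_Case

definition case_of :: "nat \<Rightarrow> nat \<Rightarrow> nat \<Rightarrow> triple \<Rightarrow> delivery_case" where
  "case_of K L ga = (\<lambda>(u, S, T).
     let \<C> = {S' \<in> index_sets K L ga. S' \<subseteq> {u} \<union> S \<union> T} in
     if \<C> = {S} then Special_Case_1
     else if \<C> = {S, {u} \<union> T} then Special_Case_2
     else General_Case)"

definition basic_terms :: "triple \<Rightarrow> triple set" where
  "basic_terms = (\<lambda>(u, S, T). {(u, S, T)} \<union> {(t, S, ({u} \<union> T) - {t}) | t. t \<in> T})"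

inductive coded_message ::
    "nat \<Rightarrow> nat \<Rightarrow> nat \<Rightarrow> nat \<Rightarrow> triple \<Rightarrow> triple set \<Rightarrow> bool"
  for K L ga gp :: nat where
  special_case_1:
    "case_of K L ga (u, S, T) = Special_Case_1 \<Longrightarrow>
     coded_message K L ga gp (u, S, T) (basic_terms (u, S, T))"
| special_case_2:
    "case_of K L ga (u, S, T) = Special_Case_2 \<Longrightarrow> I = {u} \<union> S \<union> T \<Longrightarrow>
     j \<in> {1..2 * ga * L - 1} \<Longrightarrow> shifted I S j = {u} \<union> T \<Longrightarrow>
     coded_message K L ga gp (u, S, T)
       (basic_terms (u, S, T) \<union>
        basic_terms (shifted_elem I u j, shifted I S j, shifted I T j))"
| general_case:
    "case_of K L ga (u, S, T) = General_Case \<Longrightarrow> I = {u} \<union> S \<union> T \<Longrightarrow>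
     coded_message K L ga gp (u, S, T)
       ({(u, S, T)} \<union>
        {(shifted_elem I u i, shifted I S i, shifted I T i) | i.
           i \<in> {1..ga * L + gp} \<and> shifted I S i \<in> index_sets K L ga})"

type_synonym pending = "nat \<Rightarrow> (nat set \<times> nat set) set"

definition initial_pending :: "nat \<Rightarrow> nat \<Rightarrow> nat \<Rightarrow> nat \<Rightarrow> pending" where
  "initial_pending K L ga gp u =
     {(S, T). S \<in> index_sets K L ga \<and> u \<notin> S \<and> T \<in> nsets ({1..K} - (S \<union> {u})) gp}"

definition remove_terms :: "pending \<Rightarrow> triple set \<Rightarrow> pending" where
  "remove_terms D X u = {(S, T) \<in> D u. (u, S, T) \<notin> X}"

text \<open>
  The selection of \<open>(S, T)\<close> is arbitrary, so the delivery is a relation.  A transmission is recorded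
  with the case that produced it.
\<close>

type_synonym transmission = "delivery_case \<times> triple set"

inductive serve_user ::
    "nat \<Rightarrow> nat \<Rightarrow> nat \<Rightarrow> nat \<Rightarrow> nat \<Rightarrow> pending \<Rightarrow> transmission list \<Rightarrow> pending \<Rightarrow> bool"
  for K L ga gp u :: nat where
  finished: "D u = {} \<Longrightarrow> serve_user K L ga gp u D [] D"
| transmit:
    "(S, T) \<in> D u \<Longrightarrow> coded_message K L ga gp (u, S, T) X \<Longrightarrow>
     serve_user K L ga gp u (remove_terms D X) xs D' \<Longrightarrow>
     serve_user K L ga gp u D ((case_of K L ga (u, S, T), X) # xs) D'"

inductive serve_users ::
    "nat \<Rightarrow> nat \<Rightarrow> nat \<Rightarrow> nat \<Rightarrow> nat list \<Rightarrow> pending \<Rightarrow> transmission list \<Rightarrow> bool"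
  for K L ga gp :: nat where
  no_users: "serve_users K L ga gp [] D []"
| next_user:
    "serve_user K L ga gp u D xs D' \<Longrightarrow> serve_users K L ga gp us D' ys \<Longrightarrow>
     serve_users K L ga gp (u # us) D (xs @ ys)"

definition cw_delivery :: "nat \<Rightarrow> nat \<Rightarrow> nat \<Rightarrow> nat \<Rightarrow> transmission list \<Rightarrow> bool" where
  "cw_delivery K L ga gp xs \<longleftrightarrow>
     serve_users K L ga gp [1..<K + 1] (initial_pending K L ga gp) xs"

definition cw_transmission ::
    "(nat \<Rightarrow> nat set \<Rightarrow> nat set \<Rightarrow> 'w::len word) \<Rightarrow> (nat \<Rightarrow> nat) \<Rightarrow> transmission \<Rightarrow> 'w word" where
  "cw_transmission W d x = XOR (\<lambda>(u, S, T). W (d u) S T) (snd x)"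

end

(* With M_a = 0 the only subfile-index set is empty, so the message triggered by (u, {}, T) consists
   of the terms (s, {}, A - {s}) for s in A, where A = {u} \<union> T; it depends on A alone.  Sending it
   removes from every D_s exactly the pair belonging to A.  Hence the state of the delivery is the
   family of sets A that are still to be sent, and serving user u sends each remaining A
   containing u exactly once. *)

theory Submission
  imports Defs
begin

section \<open>Index sets and coded messages without access caches\<close>

lemma index_set_no_access [simp]: "index_set K L 0 i = {}"
  by (simp add: index_set_def)

lemma index_sets_no_access [simp]: "0 < K \<Longrightarrow> index_sets K L 0 = {{}}"
  by (simp add: index_sets_def image_constant_conv)

lemma case_of_no_access: "0 < K \<Longrightarrow> case_of K L 0 (u, {}, T) = Special_Case_1"
proof -
  assume "0 < K"
  then have "{S' \<in> index_sets K L 0. S' \<subseteq> {u} \<union> {} \<union> T} = {{}}" by auto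
  then show ?thesis by (simp add: case_of_def)
qed

definition man_terms :: "nat set \<Rightarrow> triple set" where
  "man_terms A = (\<lambda>s. (s, {}, A - {s})) ` A"

text \<open>Since \<open>u \<notin> T\<close>, removing \<open>u\<close> from
  \<open>insert u T\<close> gives back \<open>T\<close>, so the leading term is the member of
  \<open>man_terms\<close> for \<open>s = u\<close>.\<close>

lemma basic_terms_eq_man_terms:
  assumes "u \<notin> T"
  shows "basic_terms (u, {}, T) = man_terms (insert u T)"
  using assms by (auto simp: basic_terms_def man_terms_def)

text \<open>The rules for the other two cases are excluded by \<open>case_of_no_access\<close>. The
  selected pair thus determines the message, and the only freedom left in the delivery is the
  selection itself.\<close>

lemma coded_message_no_access:
  assumes "0 < K" and "u \<notin> T"
  shows "coded_message K L 0 gp (u, {}, T) X \<longleftrightarrow> X = man_terms (insert u T)"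
proof
  assume "coded_message K L 0 gp (u, {}, T) X"
  then show "X = man_terms (insert u T)"
    using assms by cases (simp_all add: case_of_no_access basic_terms_eq_man_terms)
next
  assume "X = man_terms (insert u T)"
  then show "coded_message K L 0 gp (u, {}, T) X"
    using coded_message.special_case_1[OF case_of_no_access[OF assms(1), of L u T]] assms
    by (simp add: basic_terms_eq_man_terms)
qed

text \<open>\<open>pending_sets U \<A> D\<close>: as far as the users in \<open>U\<close> are concerned, \<open>D\<close> is the state in which
  the family \<open>\<A>\<close> is still to be sent.\<close>

definition pending_sets :: "nat set \<Rightarrow> nat set set \<Rightarrow> pending \<Rightarrow> bool" where
  "pending_sets U \<A> D \<longleftrightarrow> (\<forall>u \<in> U. D u = {({}, T) | T. u \<notin> T \<and> insert u T \<in> \<A>})"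

lemma pending_sets_initial:
  assumes "0 < K"
  shows "pending_sets {1..K} (nsets {1..K} (gp + 1)) (initial_pending K L 0 gp)"
proof -
  have "T \<in> nsets ({1..K} - {u}) gp \<longleftrightarrow> u \<notin> T \<and> insert u T \<in> nsets {1..K} (gp + 1)"
    if "u \<in> {1..K}" for u T
  \<comment> \<open>Finiteness makes the cardinality of \<open>insert u T\<close> one more than that
    of \<open>T\<close>; in the other case both sides are false.\<close>
  proof (cases "u \<notin> T \<and> finite T")
    case True
    with that show ?thesis by (simp add: nsets_def subset_Diff_insert)
  qed (auto simp: nsets_def)
  then show ?thesis
    unfolding pending_sets_def initial_pending_def index_sets_no_access[OF assms]
    by (intro ballI) auto
qed

text \<open>For \<open>u \<notin> T\<close>, the triple \<open>(u, {}, T)\<close> lies in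
  \<open>man_terms A\<close> exactly when \<open>insert u T = A\<close>, so one transmission deletes
  \<open>A\<close> for all users at once.\<close>

lemma pending_sets_remove_terms:
  assumes "pending_sets U \<A> D"
  shows "pending_sets U (\<A> - {A}) (remove_terms D (man_terms A))"
  using assms by (auto simp: pending_sets_def remove_terms_def man_terms_def)

lemma pending_sets_empty_iff:
  assumes "pending_sets U \<A> D" and "u \<in> U"
  shows "D u = {} \<longleftrightarrow> {A \<in> \<A>. u \<in> A} = {}"
proof -
  have "D u = {({}, T) | T. u \<notin> T \<and> insert u T \<in> \<A>}"
    using assms by (simp add: pending_sets_def)
  \<comment> \<open>A member of \<open>\<A>\<close> containing \<open>u\<close> is written as
    \<open>insert u T\<close> with \<open>u \<notin> T\<close>, which yields a pending pair.\<close>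
  then show ?thesis by (auto dest: mk_disjoint_insert)
qed

section \<open>Runs of the delivery\<close>

abbreviation man_message :: "nat set \<Rightarrow> transmission" where
  "man_message A \<equiv> (Special_Case_1, man_terms A)"

text \<open>A set leaves the family as soon as it is sent, whence \<open>distinct\<close>. The
  invariant is kept on all of \<open>U\<close>, not only at \<open>u\<close>, so that later users
  can start from it.\<close>

lemma serve_user_no_access:
  assumes "serve_user K L 0 gp u D xs D'" and "0 < K" and "u \<in> U" and "pending_sets U \<A> D"
  shows "\<exists>As. xs = map man_message As \<and> distinct As \<and> set As = {A \<in> \<A>. u \<in> A} \<and>
    pending_sets U (\<A> - set As) D'"
  using assms
proof (induction arbitrary: \<A> rule: serve_user.induct)
  case (finished D)
  then have "{A \<in> \<A>. u \<in> A} = {}" by (simp only: pending_sets_empty_iff)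
  then show ?case using finished.prems by (intro exI[of _ "[]"]) auto
next
  case (transmit S T D X xs D')
  define A where "A = insert u T"
  from transmit have S: "S = {}" and T: "u \<notin> T" and A: "A \<in> \<A>"
    by (auto simp: pending_sets_def A_def)
  have X: "X = man_terms A"
    using transmit.hyps S T \<open>0 < K\<close> by (simp add: coded_message_no_access A_def)
  have "pending_sets U (\<A> - {A}) (remove_terms D X)"
    using transmit.prems by (simp add: X pending_sets_remove_terms)
  from transmit.IH[OF transmit.prems(1,2) this] obtain As where
    As: "xs = map man_message As" "distinct As" "set As = {B \<in> \<A> - {A}. u \<in> B}"
      "pending_sets U (\<A> - {A} - set As) D'" by blast
  have "\<A> - set (A # As) = \<A> - {A} - set As" by auto
  with As A show ?case
    by (intro exI[of _ "A # As"])
       (auto simp: S X case_of_no_access[OF \<open>0 < K\<close>] A_def)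
qed

text \<open>Each transmission removes one set from a finite family, so a run can always be
  completed.\<close>

lemma serve_user_no_access_exists:
  assumes "0 < K" and "u \<in> U" and "finite \<A>" and "pending_sets U \<A> D"
  shows "\<exists>xs D'. serve_user K L 0 gp u D xs D'"
  using assms(3,4)
proof (induction \<A> arbitrary: D rule: finite_psubset_induct)
  case (psubset \<A>)
  show ?case
  proof (cases "D u = {}")
    case True
    then show ?thesis by (blast intro: serve_user.finished)
  next
    case False
    moreover have "D u = {({}, T) | T. u \<notin> T \<and> insert u T \<in> \<A>}"
      using psubset.prems \<open>u \<in> U\<close> by (simp add: pending_sets_def)
    ultimately obtain T where T: "({}, T) \<in> D u" "u \<notin> T" "insert u T \<in> \<A>"
      by blast
    let ?X = "man_terms (insert u T)"
    from T(3) have "\<A> - {insert u T} \<subset> \<A>" by blast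
    from psubset.IH[OF this pending_sets_remove_terms[OF psubset.prems]]
    obtain xs D' where "serve_user K L 0 gp u (remove_terms D ?X) xs D'" by blast
    with T \<open>0 < K\<close> show ?thesis
      by (blast intro: serve_user.transmit coded_message_no_access[THEN iffD2])
  qed
qed

text \<open>A set is sent while the first of its users in \<open>us\<close> is served; later users
  find it gone, so the lists of different users are disjoint.\<close>

lemma serve_users_no_access:
  assumes "serve_users K L 0 gp us D xs" and "0 < K" and "set us \<subseteq> U" and "pending_sets U \<A> D"
  shows "\<exists>As. xs = map man_message As \<and> distinct As \<and> set As = {A \<in> \<A>. A \<inter> set us \<noteq> {}}"
  using assms
proof (induction arbitrary: \<A> rule: serve_users.induct)
  case no_users
  then show ?case by auto
next
  case (next_user u D xs D' us ys)
  then have "u \<in> U" "set us \<subseteq> U" by auto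
  from serve_user_no_access[OF next_user.hyps(1) \<open>0 < K\<close> \<open>u \<in> U\<close> next_user.prems(3)]
  obtain As where As: "xs = map man_message As" "distinct As" "set As = {A \<in> \<A>. u \<in> A}"
    "pending_sets U (\<A> - set As) D'" by blast
  from next_user.IH[OF \<open>0 < K\<close> \<open>set us \<subseteq> U\<close> As(4)] obtain Bs where
    Bs: "ys = map man_message Bs" "distinct Bs" "set Bs = {A \<in> \<A> - set As. A \<inter> set us \<noteq> {}}"
    by blast
  have "set (As @ Bs) = {A \<in> \<A>. A \<inter> set (u # us) \<noteq> {}}" using As(3) Bs(3) by auto
  with As Bs show ?case by (intro exI[of _ "As @ Bs"]) auto
qed

lemma serve_users_no_access_exists:
  assumes "0 < K" and "set us \<subseteq> U" and "finite \<A>" and "pending_sets U \<A> D"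
  shows "\<exists>xs. serve_users K L 0 gp us D xs"
  using assms(2-4)
proof (induction us arbitrary: \<A> D)
  case Nil
  then show ?case by (blast intro: serve_users.no_users)
next
  case (Cons u us)
  then have "u \<in> U" "set us \<subseteq> U" by auto
  from serve_user_no_access_exists[OF \<open>0 < K\<close> \<open>u \<in> U\<close> Cons.prems(2,3)]
  obtain xs D' where xs: "serve_user K L 0 gp u D xs D'" by blast
  \<comment> \<open>\<open>\<B>\<close> is the family left after serving \<open>u\<close>; its
    inclusion in \<open>\<A>\<close> keeps it finite for the remaining users.\<close>
  from serve_user_no_access[OF xs \<open>0 < K\<close> \<open>u \<in> U\<close> Cons.prems(3)]
  obtain \<B> where "\<B> \<subseteq> \<A>" "pending_sets U \<B> D'" by blast
  with Cons.IH[OF \<open>set us \<subseteq> U\<close>, of \<B> D'] Cons.prems(2) xs show ?case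
    by (blast intro: serve_users.next_user finite_subset)
qed

text \<open>Ensures that the claims about all runs are not vacuous.\<close>

lemma cw_delivery_no_access_exists:
  assumes "0 < K"
  shows "\<exists>xs. cw_delivery K L 0 gp xs"
  unfolding cw_delivery_def
  by (rule serve_users_no_access_exists[OF assms _ _ pending_sets_initial[OF assms]])
     (auto intro: finite_imp_finite_nsets)

lemma cw_delivery_no_access:
  assumes "0 < K" and "cw_delivery K L 0 gp xs"
  obtains As where "xs = map man_message As" and "distinct As"
    and "set As = nsets {1..K} (gp + 1)"
proof -
  have users: "set [1..<K + 1] = {1..K}" by auto
  \<comment> \<open>The size \<open>gp + 1\<close> is positive, so every set contains a user and
    none stays unsent.\<close>
  have nonempty: "A \<inter> {1..K} \<noteq> {}" if "A \<in> nsets {1..K} (gp + 1)" for A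
    using that by (auto simp: nsets_def Int_absorb2)
  from serve_users_no_access[OF assms(2)[unfolded cw_delivery_def] assms(1) _
      pending_sets_initial[OF assms(1)]] users
  obtain As where "xs = map man_message As" "distinct As"
    "set As = {A \<in> nsets {1..K} (gp + 1). A \<inter> {1..K} \<noteq> {}}"
    by auto
  with nonempty that show thesis by blast
qed

text \<open>Each triple has \<open>s\<close> as its first component, so no two terms collapse and
  the XOR over triples reindexes to one over \<open>A\<close>.\<close>

lemma cw_transmission_man_message:
  "cw_transmission W d (man_message A) = man_transmission (\<lambda>n T. W n {} T) d A"
proof -
  have inj: "inj_on (\<lambda>s. (s, {} :: nat set, A - {s})) A" by (rule inj_onI) simp
  show ?thesis
    unfolding cw_transmission_def man_transmission_def man_terms_def XOR_def snd_conv
      comm_monoid_set.reindex[OF comm_monoid_set.intro[OF xor.comm_monoid_axioms] inj]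
    by (simp add: comp_def)
qed

section \<open>Subpacketization and cache contents\<close>

lemma cw_subpacketization_no_access: "cw_subpacketization K L 0 gp = K choose gp"
  by (simp add: cw_subpacketization_def subfile_numbers_def card_cartesian_product_singleton)

lemma man_subpacketization_eq: "man_subpacketization K t = K choose t"
  by (simp add: man_subpacketization_def man_subfiles_def)

lemma cw_private_cache_no_access:
  assumes "0 < K"
  shows "cw_private_cache K L N 0 gp u =
    {(n, {}, T) | n T. T \<in> nsets {1..K} gp \<and> u \<in> T \<and> n \<in> {1..N}}"
  using assms by (auto simp: cw_private_cache_def)

lemma cw_private_cache_eq_man_cache:
  assumes "0 < K"
  shows "cw_private_cache K L N 0 gp u = (\<lambda>(n, T). (n, {}, T)) ` man_cache K N gp u"
  unfolding cw_private_cache_no_access[OF assms] by (auto simp: man_cache_def man_subfiles_def)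

theorem mainTheorem4:
  fixes K L N ga gp :: nat and Ma Mp :: real
  assumes "1 \<le> L" and "L \<le> K" and "K \<le> N"
    and "Ma = 0" and "0 < Mp" and "Mp < real N"
    and "real ga = real K * Ma / real N"
    and "real gp = real K * Mp / real N"
  shows
    "(cw_subpacketization K L ga gp = K choose gp \<and> man_subpacketization K gp = K choose gp) \<and>
     (\<forall>u \<in> {1..K}.
        cw_private_cache K L N ga gp u =
          {(n, {}, T) | n T. T \<in> nsets {1..K} gp \<and> u \<in> T \<and> n \<in> {1..N}} \<and>
        cw_private_cache K L N ga gp u = (\<lambda>(n, T). (n, {}, T)) ` man_cache K N gp u) \<and>
     (\<forall>d \<in> {1..K} \<rightarrow> {1..N}.
        (\<exists>xs. cw_delivery K L ga gp xs) \<and>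
        (\<forall>xs. cw_delivery K L ga gp xs \<longrightarrow>
           (\<forall>x \<in> set xs. fst x = Special_Case_1) \<and>
           (\<exists>\<sigma>. bij_betw \<sigma> {..<length xs} (nsets {1..K} (gp + 1)) \<and>
                (\<forall>i < length xs. \<forall>W :: nat \<Rightarrow> nat set \<Rightarrow> nat set \<Rightarrow> 'w::len word.
                   cw_transmission W d (xs ! i) =
                     man_transmission (\<lambda>n T. W n {} T) d (\<sigma> i)))))"
proof -
  have ga: "ga = 0" using assms(4,7) by simp
  have K: "0 < K" using assms(1,2) by simp
  have sent: "(\<forall>x \<in> set xs. fst x = Special_Case_1) \<and>
      (\<exists>\<sigma>. bij_betw \<sigma> {..<length xs} (nsets {1..K} (gp + 1)) \<and>
        (\<forall>i < length xs. \<forall>W :: nat \<Rightarrow> nat set \<Rightarrow> nat set \<Rightarrow> 'w word.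
          cw_transmission W d (xs ! i) = man_transmission (\<lambda>n T. W n {} T) d (\<sigma> i)))"
    if delivery: "cw_delivery K L ga gp xs" for d xs
  proof -
    from K delivery obtain As where As: "xs = map man_message As" "distinct As"
      "set As = nsets {1..K} (gp + 1)"
      unfolding ga by (rule cw_delivery_no_access)
    \<comment> \<open>Lookup in \<open>As\<close> serves as \<open>\<sigma>\<close>; it is fixed
      before \<open>W\<close>, so one matching works for all file contents.\<close>
    then have "bij_betw ((!) As) {..<length xs} (nsets {1..K} (gp + 1))"
      by (intro bij_betw_nth) simp_all
    with As(1) show ?thesis
      by (intro conjI exI[of _ "(!) As"]) (auto simp: cw_transmission_man_message)
  qed
  show ?thesis
    using sent cw_delivery_no_access_exists[OF K, of L gp] cw_private_cache_no_access[OF K]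
      cw_private_cache_eq_man_cache[OF K]
    by (simp add: ga cw_subpacketization_no_access man_subpacketization_eq)
qed

end
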